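(* Given a full-order model $H(s)=C(s)K(s)^{-1}B(s)$, interpolation points $\{\sigma_j\}_{j=1}^r$, and tangent directions $\{b_i\}_{i=1}^r$ and $\{c_i\}_{i=1}^r$, let the inexact solutions $\widetilde v_j$ for $K(\sigma_j)^{-1}B(\sigma_j)b_j$ and $\widetilde w_j$ for $K(\sigma_j)^{-T}C(\sigma_j)^Tc_j$ be obtained in a Petrov-Galerkin framework (described in the context). Let $\widetilde V_r=[\widetilde v_1,\dots,\widetilde v_r]$ and $\widetilde W_r=[\widetilde w_1,\dots,\widetilde w_r]$ denote the corresponding inexact interpolatory bases. Define the residuals $$\eta_j=K(\sigma_j)\widetilde v_j-B(\sigma_j)b_j,\qquad \xi_j=K(\sigma_j)^T\widetilde w_j-C(\sigma_j)^Tc_j,$$ the residual matrices $R_b=[\eta_1,\eta_2,\dots,\eta_r]$ and $R_c=[\xi_1,\xi_2,\dots,\xi_r]$, and the rank $2r$ matrix $$F_{2r}=R_b(\widetilde W_r^T\widetilde V_r)^{-1}\widetilde W_r^T+\widetilde V_r(\widetilde W_r^T\widetilde V_r)^{-1}R_c^T .$$ Let $\widetilde H_r(s)=\widetilde C_r(s)\widetilde K_r(s)^{-1}\widetilde B_r(s)$ denote the inexact reduced model computed via the Petrov-Galerkin process, where $$\widetilde K_r(s)=\widetilde W_r^TK(s)\widetilde V_r,\qquad \widetilde B_r(s)=\widetilde W_r^TB(s),\qquad \widetilde C_r(s)=C(s)\widetilde V_r .$$ Then $\widetilde H_r(s)$ exactly tangentially interpolates the perturbed full-order model $$\widetilde H(s)=C(s)\,(K(s)+F_{2r})^{-1}B(s)$$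 at each $\sigma_i$: for each $i=1,\dots,r$, $$\widetilde H(\sigma_i)b_i=\widetilde H_r(\sigma_i)b_i,\qquad c_i^T\widetilde H(\sigma_i)=c_i^T\widetilde H_r(\sigma_i),\qquad c_i^T\widetilde H'(\sigma_i)b_i=c_i^T\widetilde H_r'(\sigma_i)b_i .$$
   Context: The full-order model is a transfer function $H(s)=C(s)K(s)^{-1}B(s)$ in which $C(s)\in\mathbb{C}^{p\times n}$ and $B(s)\in\mathbb{C}^{n\times m}$ are analytic in the right half plane, and $K(s)\in\mathbb{C}^{n\times n}$ is analytic and full rank throughout the right half plane. The interpolation points are $\sigma_j\in\mathbb{C}$ (the same points are used for left and right interpolation), the right tangent directions are $b_j\in\mathbb{C}^m$, and the left tangent directions are $c_j\in\mathbb{C}^p$. $^T$ denotes transpose and $'$ denotes the derivative in $s$. Petrov-Galerkin framework: let $\mathcal P_N$ and $\mathcal Q_N$ be $N$-dimensional subspaces of $\mathbb{C}^n$ satisfying the nondegeneracy condition $(K(\sigma_i)\mathcal P_N)^\perp\cap\mathcal Q_N=\{0\}$ for all shifts $\sigma_i$ considered. The approximate solutions are defined as follows: find $\widetilde v_j\in\mathcal P_N$ so that $K(\sigma_j)\widetilde v_j-B(\sigma_j)b_j\perp\mathcal Q_N$, and find $\widetilde w_j\in\mathcal Q_N$ so that $K(\sigma_j)^T\widetilde w_j-C(\sigma_j)^Tc_j\perp\mathcal P_N$.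
   Formalization: Sign corrected: the perturbed model is C(s)(K(s)−F_{2r})^{-1}B(s), since K+F_{2r} fails with these residuals; W^T V, W^T K(σ_i)V and K(σ_i)−F_{2r} are assumed invertible, orthogonality means x^T y=0, and rank 2r is proved when R_b, R_c have full rank. *)

theory Defs
  imports "HOL-Analysis.Analysis"
begin

definition matrix_analytic_on :: "(complex \<Rightarrow> complex^'k^'l) \<Rightarrow> complex set \<Rightarrow> bool" where
  "matrix_analytic_on M S \<longleftrightarrow> (\<forall>i j. (\<lambda>s. M s $ i $ j) analytic_on S)"

definition matrix_deriv :: "(complex \<Rightarrow> complex^'k^'l) \<Rightarrow> complex \<Rightarrow> complex^'k^'l" where
  "matrix_deriv M s = (\<chi> i j. deriv (\<lambda>z. M z $ i $ j) s)"

definition transfer_function ::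
  "(complex \<Rightarrow> complex^'n^'p) \<Rightarrow> (complex \<Rightarrow> complex^'n^'n) \<Rightarrow> (complex \<Rightarrow> complex^'m^'n)
    \<Rightarrow> complex \<Rightarrow> complex^'m^'p" where
  "transfer_function C K B s = C s ** matrix_inv (K s) ** B s"

definition from_columns :: "('r \<Rightarrow> complex^'n) \<Rightarrow> complex^'r^'n" where
  "from_columns v = (\<chi> i j. v j $ i)"

text \<open>
  Orthogonality is taken with respect to the bilinear form \<open>x\<^sup>T y\<close>, without complex
  conjugation, to match the plain transposes in the left equations
  \<open>K(\<sigma>)\<^sup>T w - C(\<sigma>)\<^sup>T c \<bottom> P\<close> and in the reduced model \<open>W\<^sup>T K(s) V\<close>.
\<close>

definition orth_compl :: "(complex^'n) set \<Rightarrow> (complex^'n) set" where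
  "orth_compl S = {y. \<forall>x\<in>S. scalar_product x y = 0}"

definition nondegenerate ::
  "(complex^'n) set \<Rightarrow> (complex^'n) set \<Rightarrow> complex^'n^'n \<Rightarrow> bool" where
  "nondegenerate P Q A \<longleftrightarrow> orth_compl ((*v) A ` P) \<inter> Q = {0}"

text \<open>\<open>x\<close> is the approximation from \<open>U\<close> to the solution of \<open>A x = f\<close> with residual
  orthogonal to \<open>T\<close>.\<close>

definition petrov_galerkin_solution ::
  "(complex^'n) set \<Rightarrow> (complex^'n) set \<Rightarrow> complex^'n^'n \<Rightarrow> complex^'n \<Rightarrow> complex^'n \<Rightarrow> bool" where
  "petrov_galerkin_solution U T A f x \<longleftrightarrow> x \<in> U \<and> A *v x - f \<in> orth_compl T"

text \<open>The matrix \<open>F = R\<^sub>b (W\<^sup>T V)\<^sup>-\<^sup>1 W\<^sup>T + V (W\<^sup>T V)\<^sup>-\<^sup>1 R\<^sub>c\<^sup>T\<close>.\<close>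

definition backward_perturbation ::
  "complex^'r^'n \<Rightarrow> complex^'r^'n \<Rightarrow> complex^'r^'n \<Rightarrow> complex^'r^'n \<Rightarrow> complex^'n^'n" where
  "backward_perturbation V W R\<^sub>b R\<^sub>c =
     R\<^sub>b ** matrix_inv (transpose W ** V) ** transpose W
     + V ** matrix_inv (transpose W ** V) ** transpose R\<^sub>c"

text \<open>
  The perturbed full-order model is the transfer function of \<open>C\<close>, \<open>K - F\<close>, \<open>B\<close>, with a
  minus sign. By Petrov-Galerkin orthogonality
  \<open>W\<^sup>T R\<^sub>b = 0\<close> and \<open>R\<^sub>c\<^sup>T V = 0\<close>, so \<open>F v\<^sub>j = \<eta>\<^sub>j\<close>. With the residual
  \<open>\<eta>\<^sub>j = K(\<sigma>\<^sub>j) v\<^sub>j - B(\<sigma>\<^sub>j) b\<^sub>j\<close> this gives \<open>(K(\<sigma>\<^sub>j) - F) v\<^sub>j = B(\<sigma>\<^sub>j) b\<^sub>j\<close>, whereas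
  \<open>(K(\<sigma>\<^sub>j) + F) v\<^sub>j = B(\<sigma>\<^sub>j) b\<^sub>j + 2 \<eta>\<^sub>j\<close>. Writing the perturbed model with \<open>K + F\<close>
  requires residuals of the opposite sign. With the present residuals it fails to interpolate:
  for \<open>n = 2\<close>, \<open>m = p = r = 1\<close>, \<open>K = I\<close>, \<open>B = (1,\<beta>)\<^sup>T\<close>, \<open>C = (1,\<gamma>)\<close>, \<open>b = c = 1\<close>
  and both subspaces spanned by \<open>e\<^sub>1\<close>, the reduced model is \<open>1\<close>, while
  \<open>C (K + F)\<^sup>-\<^sup>1 B = (1 + 3 \<beta> \<gamma>) / (1 - \<beta> \<gamma>)\<close> and \<open>C (K - F)\<^sup>-\<^sup>1 B = 1\<close>.
\<close>

definition reduced_model ::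
  "(complex \<Rightarrow> complex^'n^'p) \<Rightarrow> (complex \<Rightarrow> complex^'n^'n) \<Rightarrow> (complex \<Rightarrow> complex^'m^'n)
    \<Rightarrow> complex^'r^'n \<Rightarrow> complex^'r^'n \<Rightarrow> complex \<Rightarrow> complex^'m^'p" where
  "reduced_model C K B V W =
     transfer_function (\<lambda>s. C s ** V) (\<lambda>s. transpose W ** K s ** V) (\<lambda>s. transpose W ** B s)"

end

theory Submission
  imports Defs
begin

text \<open>
  Petrov-Galerkin orthogonality gives \<open>W\<^sup>T R\<^sub>b = 0\<close> and \<open>R\<^sub>c\<^sup>T V = 0\<close>, hence
  \<open>F V = R\<^sub>b\<close> and \<open>W\<^sup>T F = R\<^sub>c\<^sup>T\<close>. So the inexact solutions are exact solutions of the perturbed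
  systems: \<open>(K(\<sigma>\<^sub>j) - F) v\<^sub>j = B(\<sigma>\<^sub>j) b\<^sub>j\<close> and \<open>w\<^sub>j\<^sup>T (K(\<sigma>\<^sub>j) - F) = c\<^sub>j\<^sup>T C(\<sigma>\<^sub>j)\<close>, while the
  reduced systems have the unit vector \<open>e\<^sub>j\<close> as their left and right solution. Both models
  therefore have the same tangential values, and differentiating \<open>C K\<^sup>-\<^sup>1 B\<close> shows that the
  derivative, tested with \<open>c\<^sub>j\<close> and \<open>b\<^sub>j\<close>, is in both cases
  \<open>c\<^sub>j\<^sup>T C' v\<^sub>j - w\<^sub>j\<^sup>T K' v\<^sub>j + w\<^sub>j\<^sup>T B' b\<^sub>j\<close>. For the rank, the row space of \<open>F\<close> lies in the
  sum of the ranges of \<open>W\<close> and \<open>R\<^sub>c\<close>. If \<open>R\<^sub>b\<close> and \<open>R\<^sub>c\<close> have full rank, it is all of that sum, and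
  the sum is direct because \<open>V\<^sup>T R\<^sub>c = 0\<close> while \<open>V\<^sup>T W\<close> is invertible.
\<close>

section \<open>Matrix algebra, row spaces and rank\<close>

lemma matrix_inv_right_left:
  fixes A :: "'a::semiring_1^'n^'n"
  assumes "invertible A"
  shows "A ** matrix_inv A = mat 1" and "matrix_inv A ** A = mat 1"
proof -
  have "A ** matrix_inv A = mat 1 \<and> matrix_inv A ** A = mat 1"
    unfolding matrix_inv_def using assms unfolding invertible_def by (rule someI_ex)
  then show "A ** matrix_inv A = mat 1" and "matrix_inv A ** A = mat 1" by auto
qed

lemma matrix_mul_uminus_right:
  fixes A :: "'a::ring_1^'n^'m" and D :: "'a^'k^'n"
  shows "A ** (- D) = - (A ** D)"
  by (simp add: matrix_matrix_mult_def vec_eq_iff sum_negf)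

lemma matrix_mul_uminus_left:
  fixes A :: "'a::ring_1^'n^'m" and D :: "'a^'k^'n"
  shows "(- A) ** D = - (A ** D)"
  by (simp add: matrix_matrix_mult_def vec_eq_iff sum_negf)

lemma scalar_product_matrix_vector:
  fixes A :: "'a::comm_semiring_1^'n^'m"
  shows "scalar_product x (A *v y) = scalar_product (x v* A) y"
  unfolding scalar_product_def matrix_vector_mult_def vector_matrix_mult_def
  by (simp add: sum_distrib_left sum_distrib_right mult.assoc, subst sum.swap)
    (simp add: ac_simps)

lemma matrix_mul_add_rdistrib:
  fixes A B :: "'a::semiring_1^'n^'m"
  shows "(A + B) ** D = A ** D + B ** D"
  by (simp add: matrix_matrix_mult_def vec_eq_iff distrib_right sum.distrib)

lemma matrix_mul_diff_rdistrib:
  fixes A B :: "'a::ring_1^'n^'m"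
  shows "(A - B) ** D = A ** D - B ** D"
  by (simp add: matrix_matrix_mult_def vec_eq_iff left_diff_distrib sum_subtractf)

lemma matrix_vector_mul_axis:
  fixes A :: "'a::semiring_1^'n^'m"
  shows "A *v axis j 1 = column j A"
  by (simp add: matrix_vector_mult_def column_def axis_def vec_eq_iff if_distrib cong: if_cong)

lemma from_columns_axis: "from_columns v *v axis j 1 = v j"
  by (simp add: matrix_vector_mul_axis from_columns_def column_def vec_eq_iff)

lemma transpose_0: "transpose 0 = (0::'a::zero^'n^'m)"
  by (simp add: transpose_def vec_eq_iff)

text \<open>Turns orthogonality between two families of vectors into a matrix equation: the product
  is their matrix of pairings, with no conjugation.\<close>

lemma transpose_from_columns_mul_from_columns:
  "transpose (from_columns x) ** from_columns y = (\<chi> i j. scalar_product (x i) (y j))"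
  by (simp add: transpose_def from_columns_def matrix_matrix_mult_def scalar_product_def vec_eq_iff)

lemma subspace_range_matrix_vector:
  fixes A :: "'a::field^'n^'m"
  shows "vec.subspace (range ((*v) A))"
  using vec.subspace_image[OF vec.subspace_UNIV] .

text \<open>The vectors \<open>x v* A\<close> are exactly the linear combinations of the rows of
  \<open>A\<close>. This form of the rank splits well when \<open>A\<close> is a sum of
  products.\<close>

lemma rank_eq_dim_range_vector_matrix:
  fixes A :: "'a::field^'n^'m"
  shows "rank A = vec.dim (range (\<lambda>x. x v* A))"
proof -
  have "range ((*v) (transpose A)) = vec.span (rows A)"
  proof (rule antisym)
    show "range ((*v) (transpose A)) \<subseteq> vec.span (rows A)"
      using matrix_vector_mult_in_columnspace_gen[of "transpose A"]
      by (auto simp del: transpose_matrix_vector)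
    have "row i A = transpose A *v axis i 1" for i
      by (simp add: matrix_vector_mul_axis del: transpose_matrix_vector)
    then have "rows A \<subseteq> range ((*v) (transpose A))"
      unfolding rows_def by blast
    then show "vec.span (rows A) \<subseteq> range ((*v) (transpose A))"
      by (rule vec.span_minimal) (rule subspace_range_matrix_vector)
  qed
  then show ?thesis by (simp add: row_rank_def_gen vec.dim_span)
qed

text \<open>Both sides say that the rows of \<open>A\<close> span the whole space.\<close>

lemma full_rank_left_invertible:
  fixes A :: "'a::field^'n^'m"
  shows "rank A = CARD('n) \<longleftrightarrow> (\<exists>L::'a^'m^'n. L ** A = mat 1)"
  unfolding matrix_left_invertible_span_rows_gen row_rank_def_gen
  by (simp add: vec.dim_eq_full[symmetric] vec.dimension_def card_cart_basis)

lemma dim_range_matrix_vector_le: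
  fixes A :: "'a::field^'n^'m"
  shows "vec.dim (range ((*v) A)) \<le> CARD('n)"
  using vec.dim_image_le[OF matrix_vector_mul_linear_gen[of A], of UNIV]
  by (simp add: vec_dim_card card_cart_basis)

lemma dim_range_matrix_vector_left_invertible:
  fixes A :: "'a::field^'n^'m"
  assumes "L ** A = mat 1"
  shows "vec.dim (range ((*v) A)) = CARD('n)"
proof -
  have "inj ((*v) A)" using assms matrix_left_invertible_injective by blast
  then show ?thesis
    using vec.dim_image_eq[OF matrix_vector_mul_linear_gen[of A], of UNIV]
    by (simp add: vec_dim_card card_cart_basis)
qed

text \<open>Every combination of rows has the form \<open>W *v a + R *v b\<close>, so the row space
  lies in a sum of two spaces of dimension at most \<open>CARD('r)\<close>.\<close>

lemma rank_sum_mul_transpose_le: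
  fixes D D' :: "'a::field^'r^'m" and W R :: "'a^'r^'n"
  shows "rank (D ** transpose W + D' ** transpose R) \<le> 2 * CARD('r)"
proof -
  let ?F = "D ** transpose W + D' ** transpose R"
  let ?S = "{x + y |x y. x \<in> range ((*v) W) \<and> y \<in> range ((*v) R)}"
  have "x v* ?F = W *v (x v* D) + R *v (x v* D')" for x
    by (simp add: vector_matrix_left_distrib vector_matrix_mult_add_rdistrib flip: vector_matrix_mul_assoc)
  then have "range (\<lambda>x. x v* ?F) \<subseteq> ?S" by auto
  then have "rank ?F \<le> vec.dim ?S"
    unfolding rank_eq_dim_range_vector_matrix by (rule vec.dim_subset)
  also have "\<dots> \<le> vec.dim (range ((*v) W)) + vec.dim (range ((*v) R))"
    using vec.dim_sums_Int[OF subspace_range_matrix_vector[of W] subspace_range_matrix_vector[of R]]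
    by simp
  also have "\<dots> \<le> 2 * CARD('r)"
    using dim_range_matrix_vector_le[of W] dim_range_matrix_vector_le[of R] by simp
  finally show ?thesis .
qed

section \<open>Action and rank of the perturbation \<open>F\<close>\<close>

text \<open>In the first summand of \<open>F\<close> the factor \<open>transpose W ** V\<close>
  cancels its inverse; the second summand vanishes on \<open>V\<close> by orthogonality.\<close>

lemma backward_perturbation_mul_right:
  assumes "invertible (transpose W ** V)" and "transpose R\<^sub>c ** V = 0"
  shows "backward_perturbation V W R\<^sub>b R\<^sub>c ** V = R\<^sub>b"
  using assms
  by (simp add: backward_perturbation_def matrix_mul_add_rdistrib matrix_inv_right_left
      flip: matrix_mul_assoc)

lemma backward_perturbation_mul_left:
  assumes "invertible (transpose W ** V)" and "transpose W ** R\<^sub>b = 0"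
  shows "transpose W ** backward_perturbation V W R\<^sub>b R\<^sub>c = transpose R\<^sub>c"
  using assms
  by (simp add: backward_perturbation_def matrix_add_ldistrib matrix_inv_right_left
      matrix_mul_assoc)

lemma rank_backward_perturbation:
  fixes V W R\<^sub>b R\<^sub>c :: "complex^'r^'n"
  assumes inv: "invertible (transpose W ** V)"
    and orth: "transpose W ** R\<^sub>b = 0" "transpose R\<^sub>c ** V = 0"
    and full: "rank R\<^sub>b = CARD('r)" "rank R\<^sub>c = CARD('r)"
  shows "rank (backward_perturbation V W R\<^sub>b R\<^sub>c) = 2 * CARD('r)"
proof (rule antisym)
  define F where "F = backward_perturbation V W R\<^sub>b R\<^sub>c"
  define G where "G = matrix_inv (transpose W ** V)"
  show "rank (backward_perturbation V W R\<^sub>b R\<^sub>c) \<le> 2 * CARD('r)"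
    unfolding backward_perturbation_def by (rule rank_sum_mul_transpose_le)
  obtain L where L: "L ** R\<^sub>b = mat 1" using full(1) full_rank_left_invertible by blast
  obtain L' where L': "L' ** R\<^sub>c = mat 1" using full(2) full_rank_left_invertible by blast
  \<comment> \<open>Up to the invertible factor \<open>transpose G\<close>, the matrix
    \<open>transpose V\<close> inverts \<open>W\<close> from the left, while it annihilates
    \<open>R\<^sub>c\<close>. This separates the two ranges.\<close>
  have WL: "(transpose G ** transpose V) ** W = mat 1"
    using arg_cong[OF matrix_inv_right_left(1)[OF inv], of transpose]
    by (simp add: G_def matrix_transpose_mul matrix_mul_assoc)
  have RV: "transpose V ** R\<^sub>c = 0"
    using arg_cong[OF orth(2), of transpose] by (simp add: matrix_transpose_mul transpose_0)
  have cap: "range ((*v) W) \<inter> range ((*v) R\<^sub>c) = {0}"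
  proof -
    have "W *v x = 0" if "W *v x = R\<^sub>c *v y" for x y
    proof -
      have "x = (transpose G ** transpose V) *v (W *v x)"
        by (simp add: matrix_vector_mul_assoc WL)
      also have "\<dots> = (transpose G ** (transpose V ** R\<^sub>c)) *v y"
        unfolding that by (simp add: matrix_vector_mul_assoc matrix_mul_assoc)
      also have "\<dots> = 0" unfolding RV by simp
      finally show ?thesis by simp
    qed
    moreover have "0 \<in> range ((*v) W)" "0 \<in> range ((*v) R\<^sub>c)"
      by (metis matrix_vector_mult_0_right rangeI)+
    ultimately show ?thesis by auto
  qed
  have WF: "transpose W ** F = transpose R\<^sub>c"
    unfolding F_def using inv orth(1) by (rule backward_perturbation_mul_left)
  have "W *v x + R\<^sub>c *v y \<in> range (\<lambda>x. x v* F)" for x y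
  proof -
    \<comment> \<open>The left inverse \<open>L\<close> of \<open>R\<^sub>b\<close> makes
      \<open>z v* R\<^sub>b\<close> equal to \<open>x v* (transpose W ** V)\<close>, so the
      component of \<open>z v* F\<close> along \<open>W\<close> is the prescribed
      \<open>W *v x\<close>. The component along \<open>R\<^sub>c\<close> is then some
      \<open>R\<^sub>c *v u\<close>.\<close>
    define z where "z = (x v* (transpose W ** V)) v* L"
    have "z v* R\<^sub>b = x v* (transpose W ** V)"
      by (simp add: z_def vector_matrix_mul_assoc L flip: matrix_mul_assoc)
    then have "(z v* R\<^sub>b) v* G = x"
      by (simp only: vector_matrix_mul_assoc G_def matrix_inv_right_left(1)[OF inv]
          vector_matrix_mul_rid)
    moreover define u where "u = z v* (V ** G)"
    ultimately have "z v* F = W *v x + R\<^sub>c *v u"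
      by (simp add: F_def backward_perturbation_def vector_matrix_mult_add_rdistrib
          flip: G_def vector_matrix_mul_assoc)
    \<comment> \<open>By \<open>WF\<close>, row vectors of the form \<open>a v* transpose W\<close>
      contribute only along \<open>R\<^sub>c\<close>; this corrects \<open>u\<close> to
      \<open>y\<close> and leaves \<open>W *v x\<close> untouched.\<close>
    moreover have "((y - u) v* transpose W) v* F = R\<^sub>c *v (y - u)"
      unfolding vector_matrix_mul_assoc WF by simp
    ultimately have "(z + (y - u) v* transpose W) v* F = W *v x + R\<^sub>c *v y"
      by (simp add: vector_matrix_left_distrib matrix_vector_mult_diff_distrib)
    then show ?thesis by (metis rangeI)
  qed
  then have "{x + y |x y. x \<in> range ((*v) W) \<and> y \<in> range ((*v) R\<^sub>c)} \<subseteq> range (\<lambda>x. x v* F)"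
    by auto
  then have "vec.dim {x + y |x y. x \<in> range ((*v) W) \<and> y \<in> range ((*v) R\<^sub>c)} \<le> rank F"
    unfolding rank_eq_dim_range_vector_matrix by (rule vec.dim_subset)
  moreover have "vec.dim {x + y |x y. x \<in> range ((*v) W) \<and> y \<in> range ((*v) R\<^sub>c)} = 2 * CARD('r)"
    using vec.dim_sums_Int[OF subspace_range_matrix_vector[of W] subspace_range_matrix_vector[of R\<^sub>c]]
    by (simp add: cap dim_range_matrix_vector_left_invertible[OF WL]
        dim_range_matrix_vector_left_invertible[OF L'])
  ultimately show "2 * CARD('r) \<le> rank (backward_perturbation V W R\<^sub>b R\<^sub>c)"
    unfolding F_def by simp
qed

section \<open>Derivatives of matrix-valued functions\<close>

text \<open>A relational companion of \<open>matrix_deriv\<close>: it also asserts that the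
  derivatives exist, so that product and inverse rules can be chained.\<close>

definition has_matrix_derivative ::
  "(complex \<Rightarrow> complex^'k^'l) \<Rightarrow> complex^'k^'l \<Rightarrow> complex \<Rightarrow> bool" where
  "has_matrix_derivative M M' s \<longleftrightarrow>
     (\<forall>i j. ((\<lambda>z. M z $ i $ j) has_field_derivative M' $ i $ j) (at s))"

lemma matrix_deriv_eqI: "has_matrix_derivative M M' s \<Longrightarrow> matrix_deriv M s = M'"
  by (simp add: has_matrix_derivative_def matrix_deriv_def vec_eq_iff DERIV_imp_deriv)

lemma matrix_analytic_on_imp_has_matrix_derivative:
  assumes "matrix_analytic_on M S" and "s \<in> S"
  shows "has_matrix_derivative M (matrix_deriv M s) s"
  using assms unfolding has_matrix_derivative_def matrix_analytic_on_def matrix_deriv_def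
  by (auto intro!: DERIV_deriv_iff_field_differentiable[THEN iffD2] analytic_on_imp_differentiable_at)

lemma has_matrix_derivative_unique:
  "has_matrix_derivative M M' s \<Longrightarrow> has_matrix_derivative M M'' s \<Longrightarrow> M' = M''"
  using matrix_deriv_eqI by blast

lemma has_matrix_derivative_const: "has_matrix_derivative (\<lambda>z. A) 0 s"
  by (simp add: has_matrix_derivative_def)

lemma has_matrix_derivative_diff_const:
  "has_matrix_derivative M M' s \<Longrightarrow> has_matrix_derivative (\<lambda>z. M z - A) M' s"
  by (auto simp: has_matrix_derivative_def intro!: derivative_eq_intros)

lemma has_matrix_derivative_mult:
  assumes "has_matrix_derivative M M' s" and "has_matrix_derivative N N' s"
  shows "has_matrix_derivative (\<lambda>z. M z ** N z) (M' ** N s + M s ** N') s"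
  using assms unfolding has_matrix_derivative_def matrix_matrix_mult_def
  by (auto simp: sum.distrib[symmetric] ac_simps intro!: derivative_eq_intros sum.cong)

lemma has_matrix_derivative_mult_const:
  assumes "has_matrix_derivative M M' s"
  shows "has_matrix_derivative (\<lambda>z. M z ** A) (M' ** A) s"
    and "has_matrix_derivative (\<lambda>z. D ** M z) (D ** M') s"
  using has_matrix_derivative_mult[OF assms has_matrix_derivative_const[of A]]
    has_matrix_derivative_mult[OF has_matrix_derivative_const[of D] assms] by simp_all

text \<open>The Leibniz formula makes the determinant a polynomial in the entries.\<close>

lemma field_differentiable_det:
  fixes M :: "complex \<Rightarrow> complex^'n^'n"
  assumes "\<And>i j. (\<lambda>z. M z $ i $ j) field_differentiable (at s)"
  shows "(\<lambda>z. det (M z)) field_differentiable (at s)"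
proof -
  have "(\<lambda>z. \<Prod>i\<in>S. M z $ i $ p i) field_differentiable (at s)" if "finite S" for S and p :: "'n \<Rightarrow> 'n"
    using that by induction (auto intro!: derivative_intros assms)
  then show ?thesis
    unfolding det_def by (intro derivative_intros) auto
qed

text \<open>Column \<open>j\<close> of the inverse solves \<open>A *v x = axis j 1\<close>, to which
  Cramer's rule applies. Entries of the inverse are thus quotients of determinants, which gives
  their differentiability.\<close>

lemma matrix_inv_cramer:
  fixes A :: "'a::field^'n^'n"
  assumes "det A \<noteq> 0"
  shows "matrix_inv A $ i $ j = det (\<chi> k l. if l = i then axis j 1 $ k else A $ k $ l) / det A"
proof -
  have "A *v (matrix_inv A *v axis j 1) = axis j 1"
    using assms by (simp add: matrix_vector_mul_assoc matrix_inv_right_left invertible_det_nz)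
  then have "matrix_inv A *v axis j 1 =
      (\<chi> i. det (\<chi> k l. if l = i then axis j 1 $ k else A $ k $ l) / det A)"
    using cramer[OF assms] by blast
  then show ?thesis
    by (simp add: matrix_vector_mul_axis column_def vec_eq_iff)
qed

text \<open>Cramer's rule first shows that the inverse is differentiable; its derivative then
  follows by differentiating the identity \<open>matrix_inv (K z) ** K z = mat 1\<close>.\<close>

lemma has_matrix_derivative_inverse:
  fixes K :: "complex \<Rightarrow> complex^'n^'n"
  assumes K: "has_matrix_derivative K K' s" and inv: "invertible (K s)"
  shows "has_matrix_derivative (\<lambda>z. matrix_inv (K z))
           (- (matrix_inv (K s) ** K' ** matrix_inv (K s))) s"
proof -
  define X where "X = (\<lambda>z. matrix_inv (K z))"
  have Kd: "(\<lambda>z. K z $ i $ j) field_differentiable (at s)" for i j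
    using K by (auto simp: has_matrix_derivative_def field_differentiable_def)
  have dd: "(\<lambda>z. det (K z)) field_differentiable (at s)"
    using Kd by (rule field_differentiable_det)
  have "isCont (\<lambda>z. det (K z)) s"
    using dd by (rule field_differentiable_imp_continuous_at)
  \<comment> \<open>Invertibility is assumed at \<open>s\<close> alone; continuity of the
    determinant extends it to a neighbourhood, where Cramer's rule and the inverse identity
    hold.\<close>
  then have ev: "eventually (\<lambda>z. det (K z) \<noteq> 0) (nhds s)"
    using inv by (simp add: isCont_def invertible_det_nz tendsto_imp_eventually_ne
        eventually_nhds_conv_at)
  have "(\<lambda>z. X z $ i $ j) field_differentiable (at s)" for i j
  proof -
    have entry: "(\<lambda>z. if l = i then axis j 1 $ k else K z $ k $ l) field_differentiable (at s)" for k l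
      using Kd by (cases "l = i") auto
    have "(\<lambda>z. det (\<chi> k l. if l = i then axis j 1 $ k else K z $ k $ l) / det (K z))
        field_differentiable (at s)"
      by (intro field_differentiable_divide field_differentiable_det dd)
        (use inv in \<open>auto simp: invertible_det_nz Kd entry\<close>)
    moreover have "eventually (\<lambda>z. X z $ i $ j =
        det (\<chi> k l. if l = i then axis j 1 $ k else K z $ k $ l) / det (K z)) (nhds s)"
      using ev by eventually_elim (simp add: X_def matrix_inv_cramer)
    ultimately show ?thesis
      unfolding field_differentiable_def by (simp only: DERIV_cong_ev[OF refl _ refl])
  qed
  then have X: "has_matrix_derivative X (matrix_deriv X s) s"
    by (simp add: has_matrix_derivative_def matrix_deriv_def DERIV_deriv_iff_field_differentiable)
  \<comment> \<open>The product \<open>X z ** K z\<close> is the identity near \<open>s\<close>, so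
    its product-rule derivative is also a derivative of a constant and must vanish.\<close>
  have "has_matrix_derivative (\<lambda>z. mat 1 :: complex^'n^'n) (matrix_deriv X s ** K s + X s ** K') s"
    unfolding has_matrix_derivative_def
  proof (intro allI)
    fix i j
    have "eventually (\<lambda>z. (X z ** K z) $ i $ j = (mat 1 :: complex^'n^'n) $ i $ j) (nhds s)"
      using ev by eventually_elim (simp add: X_def matrix_inv_right_left invertible_det_nz)
    moreover have "((\<lambda>z. (X z ** K z) $ i $ j) has_field_derivative
        (matrix_deriv X s ** K s + X s ** K') $ i $ j) (at s)"
      using has_matrix_derivative_mult[OF X K] by (simp add: has_matrix_derivative_def)
    ultimately show "((\<lambda>z. (mat 1 :: complex^'n^'n) $ i $ j) has_field_derivative
        (matrix_deriv X s ** K s + X s ** K') $ i $ j) (at s)"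
      by (simp only: DERIV_cong_ev[OF refl _ refl])
  qed
  then have "matrix_deriv X s ** K s + X s ** K' = 0"
    using has_matrix_derivative_unique has_matrix_derivative_const by blast
  then have "matrix_deriv X s ** K s = - (X s ** K')"
    by (simp only: eq_neg_iff_add_eq_0)
  then have "matrix_deriv X s ** (K s ** X s) = - (X s ** K' ** X s)"
    by (simp add: matrix_mul_assoc matrix_mul_uminus_left)
  then have "matrix_deriv X s = - (X s ** K' ** X s)"
    using inv by (simp add: X_def matrix_inv_right_left)
  with X show ?thesis by (simp add: X_def)
qed

lemma has_matrix_derivative_transfer_function:
  assumes "has_matrix_derivative C C' s" "has_matrix_derivative K K' s"
    "has_matrix_derivative B B' s" and "invertible (K s)"
  shows "has_matrix_derivative (transfer_function C K B)
    (C' ** matrix_inv (K s) ** B s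
     - C s ** matrix_inv (K s) ** K' ** matrix_inv (K s) ** B s
     + C s ** matrix_inv (K s) ** B') s"
proof -
  have "has_matrix_derivative (\<lambda>z. C z ** matrix_inv (K z) ** B z)
     ((C' ** matrix_inv (K s) + C s ** (- (matrix_inv (K s) ** K' ** matrix_inv (K s)))) ** B s
      + C s ** matrix_inv (K s) ** B') s"
    by (intro has_matrix_derivative_mult has_matrix_derivative_inverse assms)
  then show ?thesis
    by (simp add: transfer_function_def[abs_def] matrix_mul_uminus_right matrix_mul_assoc
        matrix_mul_add_rdistrib matrix_mul_diff_rdistrib flip: diff_conv_add_uminus)
qed

section \<open>Tangential values and derivatives of transfer functions\<close>

text \<open>Replaces the inverse by any known solution \<open>x\<close> of the linear system, which
  invertibility makes unique. It serves both the perturbed and the reduced model.\<close>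

lemma transfer_function_right:
  assumes "invertible (K s)" and "K s *v x = B s *v \<beta>"
  shows "transfer_function C K B s *v \<beta> = C s *v x"
proof -
  have "matrix_inv (K s) *v (B s *v \<beta>) = x"
    by (simp add: assms matrix_inv_right_left matrix_vector_mul_assoc flip: assms(2))
  then show ?thesis
    by (simp add: transfer_function_def flip: matrix_vector_mul_assoc)
qed

lemma transfer_function_left:
  assumes "invertible (K s)" and "y v* K s = \<gamma> v* C s"
  shows "\<gamma> v* transfer_function C K B s = y v* B s"
proof -
  have "(\<gamma> v* C s) v* matrix_inv (K s) = y"
    by (simp add: assms matrix_inv_right_left vector_matrix_mul_assoc flip: assms(2))
  then show ?thesis
    by (simp add: transfer_function_def flip: vector_matrix_mul_assoc)
qed

text \<open>After testing with \<open>\<gamma>\<close> and \<open>\<beta>\<close>, each inverse in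
  the derivative stands next to \<open>B s *v \<beta>\<close> or \<open>\<gamma> v* C s\<close>, so
  \<open>x\<close> and \<open>y\<close> absorb all of them.\<close>

lemma transfer_function_deriv_tangential:
  assumes "has_matrix_derivative C C' s" "has_matrix_derivative K K' s"
    "has_matrix_derivative B B' s" and inv: "invertible (K s)"
    and x: "K s *v x = B s *v \<beta>" and y: "y v* K s = \<gamma> v* C s"
  shows "scalar_product \<gamma> (matrix_deriv (transfer_function C K B) s *v \<beta>) =
    scalar_product \<gamma> (C' *v x) - scalar_product y (K' *v x) + scalar_product y (B' *v \<beta>)"
proof -
  have x': "matrix_inv (K s) *v (B s *v \<beta>) = x"
    by (simp add: inv matrix_inv_right_left matrix_vector_mul_assoc flip: x)
  have y': "(\<gamma> v* C s) v* matrix_inv (K s) = y"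
    by (simp add: inv matrix_inv_right_left vector_matrix_mul_assoc flip: y)
  have y'': "scalar_product \<gamma> (C s *v (matrix_inv (K s) *v z)) = scalar_product y z" for z
    by (simp add: scalar_product_matrix_vector y')
  have sp: "scalar_product \<gamma> (p + q) = scalar_product \<gamma> p + scalar_product \<gamma> q"
    "scalar_product \<gamma> (p - q) = scalar_product \<gamma> p - scalar_product \<gamma> q" for p q
    by (simp_all add: scalar_product_def algebra_simps sum.distrib sum_subtractf)
  show ?thesis
    unfolding matrix_deriv_eqI[OF has_matrix_derivative_transfer_function[OF assms(1-4)]]
    by (simp add: matrix_vector_mult_add_rdistrib matrix_vector_mult_diff_rdistrib sp x' y''
        flip: matrix_vector_mul_assoc)
qed

theorem theorem4p1:
  fixes C :: "complex \<Rightarrow> complex^'n^'p"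
    and K :: "complex \<Rightarrow> complex^'n^'n"
    and B :: "complex \<Rightarrow> complex^'m^'n"
    and \<sigma> :: "'r::finite \<Rightarrow> complex"
    and b :: "'r \<Rightarrow> complex^'m"
    and c :: "'r \<Rightarrow> complex^'p"
    and P Q :: "(complex^'n) set"
    and N :: nat
    and v w :: "'r \<Rightarrow> complex^'n"
  defines "\<Omega> \<equiv> {s. 0 < Re s} \<union> range \<sigma>"
  defines "V \<equiv> from_columns v"
    and "W \<equiv> from_columns w"
  defines "\<eta> \<equiv> \<lambda>j. K (\<sigma> j) *v v j - B (\<sigma> j) *v b j"
    and "\<xi> \<equiv> \<lambda>j. transpose (K (\<sigma> j)) *v w j - transpose (C (\<sigma> j)) *v c j"
  defines "R\<^sub>b \<equiv> from_columns \<eta>"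
    and "R\<^sub>c \<equiv> from_columns \<xi>"
  defines "F \<equiv> backward_perturbation V W R\<^sub>b R\<^sub>c"
  defines "H \<equiv> transfer_function C (\<lambda>s. K s - F) B"
    and "H\<^sub>r \<equiv> reduced_model C K B V W"
  assumes "matrix_analytic_on C \<Omega>" and "matrix_analytic_on K \<Omega>" and "matrix_analytic_on B \<Omega>"
    and "\<And>s. s \<in> \<Omega> \<Longrightarrow> rank (K s) = CARD('n)"
    and "vec.subspace P" and "vec.dim P = N"
    and "vec.subspace Q" and "vec.dim Q = N"
    and "\<And>i. nondegenerate P Q (K (\<sigma> i))"
    and "\<And>j. petrov_galerkin_solution P Q (K (\<sigma> j)) (B (\<sigma> j) *v b j) (v j)"
    and "\<And>j. petrov_galerkin_solution Q P (transpose (K (\<sigma> j))) (transpose (C (\<sigma> j)) *v c j) (w j)"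
    and "invertible (transpose W ** V)"
    and "\<And>i. invertible (transpose W ** K (\<sigma> i) ** V)"
    and "\<And>i. invertible (K (\<sigma> i) - F)"
  shows "rank F \<le> 2 * CARD('r)
       \<and> (rank R\<^sub>b = CARD('r) \<and> rank R\<^sub>c = CARD('r) \<longrightarrow> rank F = 2 * CARD('r))
       \<and> (\<forall>i. H (\<sigma> i) *v b i = H\<^sub>r (\<sigma> i) *v b i
            \<and> c i v* H (\<sigma> i) = c i v* H\<^sub>r (\<sigma> i)
            \<and> scalar_product (c i) (matrix_deriv H (\<sigma> i) *v b i)
              = scalar_product (c i) (matrix_deriv H\<^sub>r (\<sigma> i) *v b i))"
proof (intro conjI impI allI)
  note an = assms(11-13) and PG = assms(20,21)
    and invWV = assms(22) and invr = assms(23) and invF = assms(24)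
  \<comment> \<open>The two Petrov-Galerkin problems interlock: the left one puts each
    \<open>w j\<close> into \<open>Q\<close>, and the right one makes every residual
    \<open>\<eta> j\<close> orthogonal to \<open>Q\<close>. The roles swap for \<open>V\<close> and
    \<open>R\<^sub>c\<close>.\<close>
  have orthb: "transpose W ** R\<^sub>b = 0"
    using PG unfolding W_def R\<^sub>b_def \<eta>_def transpose_from_columns_mul_from_columns
      petrov_galerkin_solution_def orth_compl_def by (simp add: vec_eq_iff)
  have "transpose V ** R\<^sub>c = 0"
    using PG unfolding V_def R\<^sub>c_def \<xi>_def transpose_from_columns_mul_from_columns
      petrov_galerkin_solution_def orth_compl_def by (simp add: vec_eq_iff)
  from arg_cong[OF this, of transpose] have orthc: "transpose R\<^sub>c ** V = 0"
    by (simp add: matrix_transpose_mul transpose_0)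
  show "rank F \<le> 2 * CARD('r)"
    unfolding F_def backward_perturbation_def by (rule rank_sum_mul_transpose_le)
  show "rank F = 2 * CARD('r)" if "rank R\<^sub>b = CARD('r) \<and> rank R\<^sub>c = CARD('r)"
    unfolding F_def using invWV orthb orthc that by (intro rank_backward_perturbation) auto
  fix i
  define e :: "complex^'r" where "e = axis i 1"
  have FV: "F ** V = R\<^sub>b"
    unfolding F_def using invWV orthc by (rule backward_perturbation_mul_right)
  have WF: "transpose W ** F = transpose R\<^sub>c"
    unfolding F_def using invWV orthb by (rule backward_perturbation_mul_left)
  have Ve: "V *v e = v i" and We: "W *v e = w i" and Rbe: "R\<^sub>b *v e = \<eta> i" and Rce: "R\<^sub>c *v e = \<xi> i"
    by (simp_all add: V_def W_def R\<^sub>b_def R\<^sub>c_def e_def from_columns_axis)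
  have "F *v v i = \<eta> i"
    using FV by (simp add: matrix_vector_mul_assoc Rbe flip: Ve)
  then have right: "(K (\<sigma> i) - F) *v v i = B (\<sigma> i) *v b i"
    by (simp add: matrix_vector_mult_diff_rdistrib \<eta>_def)
  have "w i v* F = e v* (transpose W ** F)"
    by (simp add: We flip: vector_matrix_mul_assoc)
  then have "w i v* F = \<xi> i"
    by (simp add: WF Rce)
  then have left: "w i v* (K (\<sigma> i) - F) = c i v* C (\<sigma> i)"
    by (simp add: vector_matrix_mult_diff_rdistrib \<xi>_def)
  \<comment> \<open>Since \<open>K (\<sigma> i) *v v i\<close> is
    \<open>B (\<sigma> i) *v b i\<close> plus the residual, projecting by \<open>transpose W\<close>
    removes the residual, and \<open>e\<close> solves the reduced system.\<close>
  have "transpose W *v \<eta> i = 0"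
    using orthb by (simp add: matrix_vector_mul_assoc flip: Rbe del: transpose_matrix_vector)
  then have rright: "(transpose W ** K (\<sigma> i) ** V) *v e = (transpose W ** B (\<sigma> i)) *v b i"
    by (simp add: Ve \<eta>_def matrix_vector_mult_diff_distrib vector_matrix_mult_diff_distrib flip: matrix_vector_mul_assoc)
  have "\<xi> i v* V = e v* (transpose R\<^sub>c ** V)"
    by (simp add: Rce flip: vector_matrix_mul_assoc)
  then have "\<xi> i v* V = 0" by (simp add: orthc)
  then have rleft: "e v* (transpose W ** K (\<sigma> i) ** V) = c i v* (C (\<sigma> i) ** V)"
    by (simp add: We \<xi>_def vector_matrix_mult_diff_distrib flip: vector_matrix_mul_assoc)
  have "H (\<sigma> i) *v b i = C (\<sigma> i) *v v i"
    unfolding H_def using invF right by (rule transfer_function_right)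
  moreover have "H\<^sub>r (\<sigma> i) *v b i = (C (\<sigma> i) ** V) *v e"
    unfolding H\<^sub>r_def reduced_model_def using invr rright by (rule transfer_function_right)
  ultimately show "H (\<sigma> i) *v b i = H\<^sub>r (\<sigma> i) *v b i"
    by (simp add: Ve flip: matrix_vector_mul_assoc)
  have "c i v* H (\<sigma> i) = w i v* B (\<sigma> i)"
    unfolding H_def using invF left by (rule transfer_function_left)
  moreover have "c i v* H\<^sub>r (\<sigma> i) = e v* (transpose W ** B (\<sigma> i))"
    unfolding H\<^sub>r_def reduced_model_def using invr rleft by (rule transfer_function_left)
  ultimately show "c i v* H (\<sigma> i) = c i v* H\<^sub>r (\<sigma> i)"
    by (simp add: We flip: vector_matrix_mul_assoc)
  \<comment> \<open>\<open>\<Omega>\<close> contains the interpolation points by construction, so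
    the coefficients are differentiable there even outside the right half plane.\<close>
  have "\<sigma> i \<in> \<Omega>" by (simp add: \<Omega>_def)
  note deriv = an[THEN matrix_analytic_on_imp_has_matrix_derivative, OF this]
  \<comment> \<open>\<open>F\<close> is constant in \<open>s\<close>, so the perturbed coefficient
    \<open>K s - F\<close> has the derivative of \<open>K\<close>.\<close>
  have "scalar_product (c i) (matrix_deriv H (\<sigma> i) *v b i) =
      scalar_product (c i) (matrix_deriv C (\<sigma> i) *v v i)
      - scalar_product (w i) (matrix_deriv K (\<sigma> i) *v v i)
      + scalar_product (w i) (matrix_deriv B (\<sigma> i) *v b i)"
    unfolding H_def using deriv(1) has_matrix_derivative_diff_const[OF deriv(2)] deriv(3)
      invF right left by (rule transfer_function_deriv_tangential)
  moreover have "scalar_product (c i) (matrix_deriv H\<^sub>r (\<sigma> i) *v b i) =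
      scalar_product (c i) ((matrix_deriv C (\<sigma> i) ** V) *v e)
      - scalar_product e ((transpose W ** matrix_deriv K (\<sigma> i) ** V) *v e)
      + scalar_product e ((transpose W ** matrix_deriv B (\<sigma> i)) *v b i)"
    unfolding H\<^sub>r_def reduced_model_def
    using has_matrix_derivative_mult_const(1)[OF deriv(1)]
      has_matrix_derivative_mult_const(1)[OF has_matrix_derivative_mult_const(2)[OF deriv(2)]]
      has_matrix_derivative_mult_const(2)[OF deriv(3)] invr rright rleft
    by (rule transfer_function_deriv_tangential)
  \<comment> \<open>Moving \<open>W\<close> across the pairing turns \<open>e\<close> into
    \<open>w i\<close>; with \<open>V *v e = v i\<close> the reduced expression becomes the
    full-order one.\<close>
  moreover have e_w: "scalar_product e (transpose W *v z) = scalar_product (w i) z" for z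
    by (simp add: scalar_product_matrix_vector We del: transpose_matrix_vector)
  ultimately show "scalar_product (c i) (matrix_deriv H (\<sigma> i) *v b i)
      = scalar_product (c i) (matrix_deriv H\<^sub>r (\<sigma> i) *v b i)"
    by (simp add: e_w Ve del: transpose_matrix_vector flip: matrix_vector_mul_assoc)
qed

end
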